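(* Let $0\to\mathfrak{h}_S\xrightarrow{i}\mathfrak{e}_U\xrightarrow{p}\mathfrak{g}_T\to0$ be an abelian extension of the Rota-Baxter Lie algebra $\mathfrak{g}_T$ by a representation $\mathfrak{h}_S$ with action map $\psi$, and let $(\chi,\Phi)$ be the $2$-cocycle associated to the extension and a fixed section $s$ of $p$. A pair $(\beta,\alpha)\in\mathrm{Aut}(\mathfrak{h}_S)\times\mathrm{Aut}(\mathfrak{g}_T)$ is inducible if and only if $\beta(\psi_xh)-\psi_{\alpha(x)}\beta(h)=0$ for all $x\in\mathfrak{g}$, $h\in\mathfrak{h}$, and there exists a linear map $\lambda\in\mathrm{Hom}(\mathfrak{g},\mathfrak{h})$ satisfying, for all $x,y\in\mathfrak{g}$, $$\beta(\chi(x,y))-\chi(\alpha(x),\alpha(y))=\psi_{\alpha(x)}\lambda(y)-\psi_{\alpha(y)}\lambda(x)-\lambda([x,y]_\mathfrak{g}),$$ $$\beta(\Phi(x))-\Phi(\alpha(x))=S(\lambda(x))-\lambda(T(x)).$$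
   Context: All vector spaces, linear maps and Lie algebras are over a field $\mathbf{k}$ of characteristic $0$. A Rota-Baxter Lie algebra $\mathfrak{g}_T$ is a Lie algebra $\mathfrak{g}$ with a linear map $T:\mathfrak{g}\to\mathfrak{g}$ satisfying $[T(x),T(y)]_\mathfrak{g}=T([T(x),y]_\mathfrak{g}+[x,T(y)]_\mathfrak{g})$ for all $x,y\in\mathfrak{g}$. A morphism $\mathfrak{g}_T\to\mathfrak{g}'_{T'}$ is a Lie algebra homomorphism $\varphi$ with $T'\circ\varphi=\varphi\circ T$; $\mathrm{Aut}(\mathfrak{g}_T)$ is the group of bijective morphisms $\mathfrak{g}_T\to\mathfrak{g}_T$. A representation $\mathfrak{h}_S$ of $\mathfrak{g}_T$ is a vector space $\mathfrak{h}$ with a Lie algebra homomorphism $\psi:\mathfrak{g}\to\mathrm{End}(\mathfrak{h})$ and a linear map $S:\mathfrak{h}\to\mathfrak{h}$ such that $\psi_{T(x)}S(h)=S(\psi_{T(x)}h+\psi_xS(h))$ for all $x\in\mathfrak{g}$, $h\in\mathfrak{h}$. Such $\mathfrak{h}_S$ is viewed as a Rota-Baxter Lie algebra with zero bracket (so $\mathrm{Aut}(\mathfrak{h}_S)$ consists of linear bijections commuting with $S$). An abelian extension of $\mathfrak{g}_T$ by the representation $\mathfrak{h}_S$ is a Rota-Baxter Lie algebra $\mathfrak{e}_U$ with a short exact sequence $0\to\mathfrak{h}_S\xrightarrow{i}\mathfrak{e}_U\xrightarrow{p}\mathfrak{g}_T\to0$ of morphisms of Rota-Baxter Lie algebras ($\mathfrak{h}$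 with zero bracket, identified with $i(\mathfrak{h})$) such that the induced representation coincides with the given one: $\psi_xh=[s(x),h]_\mathfrak{e}$ for any section $s$ of $p$, i.e. linear $s:\mathfrak{g}\to\mathfrak{e}$ with $p\circ s=\mathrm{id}_\mathfrak{g}$ (this is independent of $s$). The $2$-cocycle associated to $s$ is the pair of linear maps $\chi:\wedge^2\mathfrak{g}\to\mathfrak{h}$, $\chi(x,y)=[s(x),s(y)]_\mathfrak{e}-s[x,y]_\mathfrak{g}$, and $\Phi:\mathfrak{g}\to\mathfrak{h}$, $\Phi(x)=U(s(x))-s(T(x))$. A pair $(\beta,\alpha)\in\mathrm{Aut}(\mathfrak{h}_S)\times\mathrm{Aut}(\mathfrak{g}_T)$ is inducible if there is $\gamma\in\mathrm{Aut}(\mathfrak{e}_U)$ with $\gamma(\mathfrak{h})\subset\mathfrak{h}$, $\gamma|_\mathfrak{h}=\beta$ and $p\gamma s=\alpha$ (the map $p\gamma s$ does not depend on $s$). *)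

theory Defs
  imports HOL.Vector_Spaces
begin

text \<open>
  Vector spaces are given, as in \<^theory>\<open>HOL.Vector_Spaces\<close>, by a scalar multiplication on a whole
  type. Characteristic 0 of the ground field is the class constraint \<^class>\<open>field_char_0\<close>.
\<close>

locale lie_algebra = vector_space scale
  for scale :: "'k::field_char_0 \<Rightarrow> 'g::ab_group_add \<Rightarrow> 'g" +
  fixes bracket :: "'g \<Rightarrow> 'g \<Rightarrow> 'g"
  assumes linear_bracket_right: "Vector_Spaces.linear scale scale (\<lambda>y. bracket x y)"
    and linear_bracket_left: "Vector_Spaces.linear scale scale (\<lambda>x. bracket x y)"
    and bracket_self: "bracket x x = 0"
    and jacobi: "bracket x (bracket y z) + bracket y (bracket z x) + bracket z (bracket x y) = 0"

locale rota_baxter_lie_algebra = lie_algebra scale bracket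
  for scale :: "'k::field_char_0 \<Rightarrow> 'g::ab_group_add \<Rightarrow> 'g" and bracket +
  fixes T :: "'g \<Rightarrow> 'g"
  assumes linear_T: "Vector_Spaces.linear scale scale T"
    and rota_baxter: "bracket (T x) (T y) = T (bracket (T x) y + bracket x (T y))"

definition rb_morphism ::
    "('k::field_char_0 \<Rightarrow> 'g::ab_group_add \<Rightarrow> 'g) \<Rightarrow> ('g \<Rightarrow> 'g \<Rightarrow> 'g) \<Rightarrow> ('g \<Rightarrow> 'g) \<Rightarrow>
     ('k \<Rightarrow> 'e::ab_group_add \<Rightarrow> 'e) \<Rightarrow> ('e \<Rightarrow> 'e \<Rightarrow> 'e) \<Rightarrow> ('e \<Rightarrow> 'e) \<Rightarrow> ('g \<Rightarrow> 'e) \<Rightarrow> bool" where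
  "rb_morphism scale bracket T scale' bracket' T' \<phi> \<longleftrightarrow>
     Vector_Spaces.linear scale scale' \<phi> \<and>
     (\<forall>x y. \<phi> (bracket x y) = bracket' (\<phi> x) (\<phi> y)) \<and>
     T' \<circ> \<phi> = \<phi> \<circ> T"

definition rb_Aut ::
    "('k::field_char_0 \<Rightarrow> 'g::ab_group_add \<Rightarrow> 'g) \<Rightarrow> ('g \<Rightarrow> 'g \<Rightarrow> 'g) \<Rightarrow> ('g \<Rightarrow> 'g) \<Rightarrow> ('g \<Rightarrow> 'g) set"
  where
  "rb_Aut scale bracket T = {\<phi>. rb_morphism scale bracket T scale bracket T \<phi> \<and> bij \<phi>}"

text \<open>
  The assumptions \<open>linear_psi\<close>, \<open>linear_action\<close> and \<open>psi_bracket\<close> say that \<open>\<psi>\<close> is a Lie algebra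
  homomorphism into the endomorphisms of \<open>\<hh>\<close> with the commutator bracket.
\<close>

locale rb_representation =
  g: rota_baxter_lie_algebra scale_g bracket_g T + h: vector_space scale_h
  for scale_g :: "'k::field_char_0 \<Rightarrow> 'g::ab_group_add \<Rightarrow> 'g"
    and bracket_g :: "'g \<Rightarrow> 'g \<Rightarrow> 'g"
    and T :: "'g \<Rightarrow> 'g"
    and scale_h :: "'k \<Rightarrow> 'h::ab_group_add \<Rightarrow> 'h" +
  fixes S :: "'h \<Rightarrow> 'h"
    and \<psi> :: "'g \<Rightarrow> 'h \<Rightarrow> 'h"
  assumes linear_psi: "Vector_Spaces.linear scale_h scale_h (\<psi> x)"
    and linear_action: "Vector_Spaces.linear scale_g scale_h (\<lambda>x. \<psi> x h)"
    and psi_bracket: "\<psi> (bracket_g x y) h = \<psi> x (\<psi> y h) - \<psi> y (\<psi> x h)"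
    and linear_S: "Vector_Spaces.linear scale_h scale_h S"
    and psi_T_S: "\<psi> (T x) (S h) = S (\<psi> (T x) h + \<psi> x (S h))"

definition is_section ::
    "('k::field_char_0 \<Rightarrow> 'g::ab_group_add \<Rightarrow> 'g) \<Rightarrow> ('k \<Rightarrow> 'e::ab_group_add \<Rightarrow> 'e) \<Rightarrow>
     ('e \<Rightarrow> 'g) \<Rightarrow> ('g \<Rightarrow> 'e) \<Rightarrow> bool" where
  "is_section scale_g scale_e p s \<longleftrightarrow> Vector_Spaces.linear scale_g scale_e s \<and> p \<circ> s = id"

definition zero_bracket :: "'h \<Rightarrow> 'h \<Rightarrow> 'h::zero" where
  "zero_bracket h h' = 0"

locale abelian_extension =
  rep: rb_representation scale_g bracket_g T scale_h S \<psi> +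
  e: rota_baxter_lie_algebra scale_e bracket_e U
  for scale_g :: "'k::field_char_0 \<Rightarrow> 'g::ab_group_add \<Rightarrow> 'g"
    and bracket_g :: "'g \<Rightarrow> 'g \<Rightarrow> 'g"
    and T :: "'g \<Rightarrow> 'g"
    and scale_h :: "'k \<Rightarrow> 'h::ab_group_add \<Rightarrow> 'h"
    and S :: "'h \<Rightarrow> 'h"
    and \<psi> :: "'g \<Rightarrow> 'h \<Rightarrow> 'h"
    and scale_e :: "'k \<Rightarrow> 'e::ab_group_add \<Rightarrow> 'e"
    and bracket_e :: "'e \<Rightarrow> 'e \<Rightarrow> 'e"
    and U :: "'e \<Rightarrow> 'e" +
  fixes i :: "'h \<Rightarrow> 'e"
    and p :: "'e \<Rightarrow> 'g"
  assumes morphism_i: "rb_morphism scale_h zero_bracket S scale_e bracket_e U i"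
    and morphism_p: "rb_morphism scale_e bracket_e U scale_g bracket_g T p"
    and inj_i: "inj i"
    and exact: "range i = {e. p e = 0}"
    and surj_p: "surj p"
    and induced_representation:
      "is_section scale_g scale_e p s \<Longrightarrow> i (\<psi> x h) = bracket_e (s x) (i h)"

text \<open>
  The cocycle takes values in \<open>i(\<hh>)\<close>, which is identified with \<open>\<hh>\<close> through the inverse of the
  injection \<open>i\<close>.
\<close>

definition cocycle_chi ::
    "('g \<Rightarrow> 'g \<Rightarrow> 'g) \<Rightarrow> ('e::ab_group_add \<Rightarrow> 'e \<Rightarrow> 'e) \<Rightarrow> ('h \<Rightarrow> 'e) \<Rightarrow> ('g \<Rightarrow> 'e) \<Rightarrow> 'g \<Rightarrow> 'g \<Rightarrow> 'h"
  where
  "cocycle_chi bracket_g bracket_e i s x y = inv i (bracket_e (s x) (s y) - s (bracket_g x y))"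

definition cocycle_Phi ::
    "('g \<Rightarrow> 'g) \<Rightarrow> ('e::ab_group_add \<Rightarrow> 'e) \<Rightarrow> ('h \<Rightarrow> 'e) \<Rightarrow> ('g \<Rightarrow> 'e) \<Rightarrow> 'g \<Rightarrow> 'h" where
  "cocycle_Phi T U i s x = inv i (U (s x) - s (T x))"

context abelian_extension
begin

lemma p_diff: "p (a - b) = p a - p b"
proof -
  interpret P: Vector_Spaces.linear scale_e scale_g p
    using morphism_p by (simp add: rb_morphism_def)
  show ?thesis by (rule P.diff)
qed

lemma i_cocycle_chi:
  assumes "is_section scale_g scale_e p s"
  shows "i (cocycle_chi bracket_g bracket_e i s x y) = bracket_e (s x) (s y) - s (bracket_g x y)"
proof -
  have "p (s z) = z" for z
    using assms unfolding is_section_def by (metis comp_apply id_apply)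
  then have "p (bracket_e (s x) (s y) - s (bracket_g x y)) = 0"
    using morphism_p by (simp add: p_diff rb_morphism_def)
  then show ?thesis
    unfolding cocycle_chi_def by (intro f_inv_into_f) (simp add: exact)
qed

lemma i_cocycle_Phi:
  assumes "is_section scale_g scale_e p s"
  shows "i (cocycle_Phi T U i s x) = U (s x) - s (T x)"
proof -
  have s: "p (s z) = z" for z
    using assms unfolding is_section_def by (metis comp_apply id_apply)
  have "p (U a) = T (p a)" for a
    using morphism_p unfolding rb_morphism_def by (metis comp_apply)
  then have "p (U (s x) - s (T x)) = 0"
    by (simp add: p_diff s)
  then show ?thesis
    unfolding cocycle_Phi_def by (intro f_inv_into_f) (simp add: exact)
qed

end

text \<open>
  For \<open>\<gamma>\<close> preserving \<open>i(\<hh>)\<close> the map \<open>p \<circ> \<gamma> \<circ> s\<close> is the same for all sections \<open>s\<close>, and sections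
  exist because \<open>p\<close> is a surjective linear map over a field; so the quantifier over \<open>s\<close> below may
  equally be read as universal or existential.
\<close>

definition inducible ::
    "('k::field_char_0 \<Rightarrow> 'g::ab_group_add \<Rightarrow> 'g) \<Rightarrow>
     ('k \<Rightarrow> 'e::ab_group_add \<Rightarrow> 'e) \<Rightarrow> ('e \<Rightarrow> 'e \<Rightarrow> 'e) \<Rightarrow> ('e \<Rightarrow> 'e) \<Rightarrow>
     ('h \<Rightarrow> 'e) \<Rightarrow> ('e \<Rightarrow> 'g) \<Rightarrow> ('h \<Rightarrow> 'h) \<Rightarrow> ('g \<Rightarrow> 'g) \<Rightarrow> bool" where
  "inducible scale_g scale_e bracket_e U i p \<beta> \<alpha> \<longleftrightarrow>
     (\<exists>\<gamma> \<in> rb_Aut scale_e bracket_e U.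
        \<gamma> ` range i \<subseteq> range i \<and>
        (\<forall>h. \<gamma> (i h) = i (\<beta> h)) \<and>
        (\<forall>s. is_section scale_g scale_e p s \<longrightarrow> p \<circ> \<gamma> \<circ> s = \<alpha>))"

end

theory Submission
  imports Defs
begin

text \<open>
  A section \<open>s\<close> splits the extension as a vector space: every element of \<open>\<ee>\<close> is
  \<open>s x + i h\<close> for exactly one pair \<open>(x, h)\<close>. In these coordinates

    \<open>[s x + i h, s y + i k] = s [x, y] + i (\<chi> x y + \<psi> x k - \<psi> y h)\<close>,
    \<open>U (s x + i h) = s (T x) + i (\<Phi> x + S h)\<close>,

  so the cocycle is exactly what distinguishes \<open>\<ee>\<close> from the semidirect product.

  A linear map \<open>\<gamma>\<close> that restricts to \<open>\<beta>\<close> on \<open>\<hh>\<close> and descends to \<open>\<alpha>\<close> on \<open>\<gg>\<close> has to be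
  block triangular, \<open>\<gamma> (s x + i h) = s (\<alpha> x) + i (l x + \<beta> h)\<close>, and its only free datum is
  the linear off-diagonal block \<open>l\<close>. Such a \<open>\<gamma>\<close> is bijective as soon as its diagonal blocks
  \<open>\<alpha>\<close> and \<open>\<beta>\<close> are. Comparing coordinates, \<open>\<gamma>\<close> preserves brackets iff the two actions
  are compatible and the equation for \<open>\<chi>\<close> holds (\<open>block_map_bracket_iff\<close>), and it commutes
  with \<open>U\<close> iff the equation for \<open>\<Phi>\<close> holds (\<open>block_map_U_iff\<close>). Both are equivalences, so
  each direction of the theorem only needs to pass between \<open>\<gamma>\<close> and \<open>l\<close>.
\<close>

section \<open>Extensions with a chosen section\<close>

locale sectioned_extension =
  abelian_extension scale_g bracket_g T scale_h S \<psi> scale_e bracket_e U i p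
  for scale_g :: "'k::field_char_0 \<Rightarrow> 'g::ab_group_add \<Rightarrow> 'g"
    and bracket_g :: "'g \<Rightarrow> 'g \<Rightarrow> 'g"
    and T :: "'g \<Rightarrow> 'g"
    and scale_h :: "'k \<Rightarrow> 'h::ab_group_add \<Rightarrow> 'h"
    and S :: "'h \<Rightarrow> 'h"
    and \<psi> :: "'g \<Rightarrow> 'h \<Rightarrow> 'h"
    and scale_e :: "'k \<Rightarrow> 'e::ab_group_add \<Rightarrow> 'e"
    and bracket_e :: "'e \<Rightarrow> 'e \<Rightarrow> 'e"
    and U :: "'e \<Rightarrow> 'e"
    and i :: "'h \<Rightarrow> 'e"
    and p :: "'e \<Rightarrow> 'g" +
  fixes s :: "'g \<Rightarrow> 'e"
  assumes section_s: "is_section scale_g scale_e p s"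
begin

abbreviation \<chi> :: "'g \<Rightarrow> 'g \<Rightarrow> 'h" where
  "\<chi> \<equiv> cocycle_chi bracket_g bracket_e i s"

abbreviation \<Phi> :: "'g \<Rightarrow> 'h" where
  "\<Phi> \<equiv> cocycle_Phi T U i s"

sublocale inc: Vector_Spaces.linear scale_h scale_e i
  using morphism_i by (simp add: rb_morphism_def)

sublocale proj: Vector_Spaces.linear scale_e scale_g p
  using morphism_p by (simp add: rb_morphism_def)

sublocale sec: Vector_Spaces.linear scale_g scale_e s
  using section_s by (simp add: is_section_def)

sublocale S: Vector_Spaces.linear scale_h scale_h S
  by (rule rep.linear_S)

sublocale U: Vector_Spaces.linear scale_e scale_e U
  by (rule e.linear_T)

sublocale act: Vector_Spaces.linear scale_h scale_h "\<psi> x"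
  by (rule rep.linear_psi)

lemma psi_zero_left [simp]: "\<psi> 0 h = 0"
proof -
  interpret Vector_Spaces.linear scale_g scale_h "\<lambda>x. \<psi> x h"
    by (rule rep.linear_action)
  show ?thesis by (rule zero)
qed

lemma bracket_e_add_right: "bracket_e a (b + c) = bracket_e a b + bracket_e a c"
proof -
  interpret Vector_Spaces.linear scale_e scale_e "bracket_e a"
    by (rule e.linear_bracket_right)
  show ?thesis by (rule add)
qed

lemma bracket_e_add_left: "bracket_e (a + b) c = bracket_e a c + bracket_e b c"
proof -
  interpret Vector_Spaces.linear scale_e scale_e "\<lambda>a. bracket_e a c"
    by (rule e.linear_bracket_left)
  show ?thesis by (rule add)
qed

lemma bracket_e_commute: "bracket_e a b = - bracket_e b a"
proof -
  have "bracket_e a b + bracket_e b a = bracket_e a (a + b) + bracket_e b (a + b)"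
    by (simp add: bracket_e_add_right e.bracket_self)
  also have "\<dots> = 0"
    by (simp only: bracket_e_add_left[symmetric] e.bracket_self)
  finally show ?thesis
    by (simp add: eq_neg_iff_add_eq_0)
qed

lemma bracket_g_zero_right [simp]: "bracket_g x 0 = 0"
proof -
  interpret Vector_Spaces.linear scale_g scale_g "bracket_g x"
    by (rule rep.g.linear_bracket_right)
  show ?thesis by (rule zero)
qed

lemma p_s [simp]: "p (s x) = x"
  using section_s unfolding is_section_def by (metis comp_apply id_apply)

lemma p_i [simp]: "p (i h) = 0"
  using exact by blast

lemma i_eq_iff [simp]: "i h = i k \<longleftrightarrow> h = k"
  using inj_i by (simp add: inj_eq)

section \<open>Coordinates on the extension\<close>

definition fibre_part :: "'e \<Rightarrow> 'h" where
  "fibre_part e = inv i (e - s (p e))"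

lemma decompose: "s (p e) + i (fibre_part e) = e"
proof -
  have "e - s (p e) \<in> range i"
    by (simp add: exact proj.diff)
  then show ?thesis
    by (simp add: fibre_part_def f_inv_into_f)
qed

lemma fibre_part_coordinates [simp]: "fibre_part (s x + i h) = h"
  using inj_i by (simp add: fibre_part_def proj.add)

lemma coordinates_eq_iff: "s x + i h = s y + i k \<longleftrightarrow> x = y \<and> h = k"
proof
  assume eq: "s x + i h = s y + i k"
  have "x = y"
    using arg_cong[OF eq, of p] by (simp only: proj.add p_s p_i add_0_right)
  moreover have "h = k"
    using arg_cong[OF eq, of fibre_part] by (simp only: fibre_part_coordinates)
  ultimately show "x = y \<and> h = k" ..
qed simp

lemma all_coordinates: "(\<forall>e. P e) \<longleftrightarrow> (\<forall>x h. P (s x + i h))"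
  by (metis decompose)

lemma linear_fibre_part: "Vector_Spaces.linear scale_e scale_h fibre_part"
proof -
  have "fibre_part (a + b) = fibre_part a + fibre_part b" for a b
  proof -
    have "a + b = s (p a + p b) + i (fibre_part a + fibre_part b)"
      using decompose[of a] decompose[of b]
      by (simp add: sec.add inc.add algebra_simps)
    then show ?thesis by (metis fibre_part_coordinates)
  qed
  moreover have "fibre_part (scale_e c a) = scale_h c (fibre_part a)" for c a
  proof -
    have "scale_e c a = s (scale_g c (p a)) + i (scale_h c (fibre_part a))"
      by (metis decompose e.scale_right_distrib sec.scale inc.scale)
    then show ?thesis by (metis fibre_part_coordinates)
  qed
  ultimately show ?thesis
    by unfold_locales auto
qed

text \<open>
  There is no term in both \<open>h\<close> and \<open>k\<close> because \<open>\<hh>\<close> is abelian; the mixed terms are the induced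
  action, and \<open>\<chi>\<close> is the defect of \<open>s\<close> as a homomorphism.
\<close>

lemma bracket_coordinates:
  "bracket_e (s x + i h) (s y + i k) = s (bracket_g x y) + i (\<chi> x y + \<psi> x k - \<psi> y h)"
proof -
  have "bracket_e (i h) (i k) = 0"
    using morphism_i inc.zero by (simp add: rb_morphism_def zero_bracket_def)
  moreover have "bracket_e (s x) (i k) = i (\<psi> x k)" for x k
    using induced_representation[OF section_s] by simp
  moreover from this have "bracket_e (i h) (s y) = - i (\<psi> y h)"
    by (metis bracket_e_commute)
  moreover have "bracket_e (s x) (s y) = s (bracket_g x y) + i (\<chi> x y)"
    by (simp add: i_cocycle_chi[OF section_s])
  ultimately show ?thesis
    by (simp add: bracket_e_add_left bracket_e_add_right inc.add inc.diff)
qed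

lemma U_coordinates: "U (s x + i h) = s (T x) + i (\<Phi> x + S h)"
proof -
  have "U (i h) = i (S h)"
    using morphism_i unfolding rb_morphism_def by (metis comp_apply)
  moreover have "U (s x) = s (T x) + i (\<Phi> x)"
    by (simp add: i_cocycle_Phi[OF section_s])
  ultimately show ?thesis
    by (simp add: U.add inc.add)
qed

lemma chi_zero_right [simp]: "\<chi> x 0 = 0"
proof -
  have "i (\<chi> x 0) = i 0"
    using bracket_e_add_right[of "s x" 0 0]
    by (simp add: i_cocycle_chi[OF section_s] sec.zero inc.zero)
  then show ?thesis by (simp only: i_eq_iff)
qed

section \<open>Block triangular maps\<close>

definition block_map :: "('h \<Rightarrow> 'h) \<Rightarrow> ('g \<Rightarrow> 'g) \<Rightarrow> ('g \<Rightarrow> 'h) \<Rightarrow> 'e \<Rightarrow> 'e" where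
  "block_map \<beta> \<alpha> l e = s (\<alpha> (p e)) + i (l (p e) + \<beta> (fibre_part e))"

lemma block_map_coordinates [simp]:
  "block_map \<beta> \<alpha> l (s x + i h) = s (\<alpha> x) + i (l x + \<beta> h)"
  by (simp add: block_map_def proj.add)

lemma linear_block_map:
  assumes "Vector_Spaces.linear scale_h scale_h \<beta>"
    and "Vector_Spaces.linear scale_g scale_g \<alpha>"
    and "Vector_Spaces.linear scale_g scale_h l"
  shows "Vector_Spaces.linear scale_e scale_e (block_map \<beta> \<alpha> l)"
proof -
  interpret \<beta>: Vector_Spaces.linear scale_h scale_h \<beta> by fact
  interpret \<alpha>: Vector_Spaces.linear scale_g scale_g \<alpha> by fact
  interpret l: Vector_Spaces.linear scale_g scale_h l by fact
  interpret f: Vector_Spaces.linear scale_e scale_h fibre_part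
    by (rule linear_fibre_part)
  show ?thesis
    by unfold_locales
      (simp_all add: block_map_def proj.add \<alpha>.add \<beta>.add l.add f.add sec.add inc.add
        proj.scale \<alpha>.scale \<beta>.scale l.scale f.scale sec.scale inc.scale
        e.scale_right_distrib algebra_simps)
qed

text \<open>
  A triangular system is solved from the diagonal: first for the base coordinate, then for the
  fibre coordinate with the off-diagonal term moved to the other side.
\<close>

lemma bij_block_map:
  assumes "bij \<beta>" and "bij \<alpha>"
  shows "bij (block_map \<beta> \<alpha> l)"
proof (rule bijI)
  show "inj (block_map \<beta> \<alpha> l)"
  proof (rule injI)
    fix a b assume "block_map \<beta> \<alpha> l a = block_map \<beta> \<alpha> l b"
    then have *: "\<alpha> (p a) = \<alpha> (p b)"
      "l (p a) + \<beta> (fibre_part a) = l (p b) + \<beta> (fibre_part b)"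
      by (simp_all add: block_map_def coordinates_eq_iff)
    then have "p a = p b"
      using \<open>bij \<alpha>\<close> by (simp add: bij_is_inj inj_eq)
    moreover from this have "fibre_part a = fibre_part b"
      using * \<open>bij \<beta>\<close> by (simp add: bij_is_inj inj_eq)
    ultimately show "a = b"
      by (metis decompose)
  qed
  show "surj (block_map \<beta> \<alpha> l)"
  proof (rule surjI)
    fix e
    let ?x = "inv \<alpha> (p e)"
    show "block_map \<beta> \<alpha> l (s ?x + i (inv \<beta> (fibre_part e - l ?x))) = e"
      using assms by (simp add: bij_is_surj surj_f_inv_f decompose)
  qed
qed

text \<open>
  Conversely, \<open>\<gamma>\<close> determines the off-diagonal block as \<open>l x = i\<inverse> (\<gamma> (s x) - s (\<alpha> x))\<close>, the
  fibre part of \<open>\<gamma> (s x)\<close>.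
\<close>

lemma block_map_exhaustive:
  assumes lin: "Vector_Spaces.linear scale_e scale_e \<gamma>"
    and restrict: "\<And>h. \<gamma> (i h) = i (\<beta> h)"
    and descend: "\<And>x. p (\<gamma> (s x)) = \<alpha> x"
  obtains l where "Vector_Spaces.linear scale_g scale_h l" and "\<gamma> = block_map \<beta> \<alpha> l"
proof
  interpret \<gamma>: Vector_Spaces.linear scale_e scale_e \<gamma> by fact
  let ?l = "fibre_part \<circ> (\<gamma> \<circ> s)"
  show "Vector_Spaces.linear scale_g scale_h ?l"
    by (intro Vector_Spaces.linear_compose[OF _ linear_fibre_part]
        Vector_Spaces.linear_compose[OF _ lin] sec.linear_axioms)
  show "\<gamma> = block_map \<beta> \<alpha> ?l"
  proof
    fix e
    have "\<gamma> e = \<gamma> (s (p e)) + \<gamma> (i (fibre_part e))"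
      by (metis decompose \<gamma>.add)
    also have "\<gamma> (s (p e)) = s (\<alpha> (p e)) + i (?l (p e))"
      using decompose[of "\<gamma> (s (p e))"] by (simp add: descend)
    finally show "\<gamma> e = block_map \<beta> \<alpha> ?l e"
      by (simp add: block_map_def restrict inc.add add.assoc)
  qed
qed

section \<open>When a block triangular map is an automorphism\<close>

text \<open>
  The base coordinates of both sides agree because \<open>\<alpha>\<close> is a homomorphism. The fibre coordinates
  give one equation in \<open>(x, h)\<close> and \<open>(y, k)\<close> that separates: its value at \<open>h = k = 0\<close> is the
  equation for \<open>\<chi>\<close>, and its value at \<open>h = y = 0\<close> is the compatibility of the actions.
\<close>

lemma block_map_bracket_iff:
  assumes "Vector_Spaces.linear scale_h scale_h \<beta>"
    and "Vector_Spaces.linear scale_g scale_g \<alpha>"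
    and hom: "\<And>x y. \<alpha> (bracket_g x y) = bracket_g (\<alpha> x) (\<alpha> y)"
    and "Vector_Spaces.linear scale_g scale_h l"
  shows "(\<forall>a b. block_map \<beta> \<alpha> l (bracket_e a b)
      = bracket_e (block_map \<beta> \<alpha> l a) (block_map \<beta> \<alpha> l b)) \<longleftrightarrow>
    (\<forall>x h. \<beta> (\<psi> x h) - \<psi> (\<alpha> x) (\<beta> h) = 0) \<and>
    (\<forall>x y. \<beta> (\<chi> x y) - \<chi> (\<alpha> x) (\<alpha> y) =
       \<psi> (\<alpha> x) (l y) - \<psi> (\<alpha> y) (l x) - l (bracket_g x y))"
    (is "?preserves \<longleftrightarrow> ?compatible \<and> ?chi")
proof -
  interpret \<beta>: Vector_Spaces.linear scale_h scale_h \<beta> by fact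
  interpret \<alpha>: Vector_Spaces.linear scale_g scale_g \<alpha> by fact
  interpret l: Vector_Spaces.linear scale_g scale_h l by fact
  have "?preserves \<longleftrightarrow> (\<forall>x h y k.
      l (bracket_g x y) + (\<beta> (\<chi> x y) + \<beta> (\<psi> x k) - \<beta> (\<psi> y h)) =
      \<chi> (\<alpha> x) (\<alpha> y) + (\<psi> (\<alpha> x) (l y) + \<psi> (\<alpha> x) (\<beta> k))
        - (\<psi> (\<alpha> y) (l x) + \<psi> (\<alpha> y) (\<beta> h)))"
    (is "_ \<longleftrightarrow> ?fibre")
    by (simp add: all_coordinates bracket_coordinates coordinates_eq_iff hom
        \<beta>.add \<beta>.diff act.add)
  also have "\<dots> \<longleftrightarrow> ?compatible \<and> ?chi"
  proof
    assume fibre: ?fibre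
    have ?compatible
    proof (intro allI)
      fix x k
      show "\<beta> (\<psi> x k) - \<psi> (\<alpha> x) (\<beta> k) = 0"
        using fibre[rule_format, where x = x and h = 0 and y = 0 and k = k]
        by (simp add: \<beta>.zero \<alpha>.zero l.zero act.zero)
    qed
    moreover have ?chi
    proof (intro allI)
      fix x y
      show "\<beta> (\<chi> x y) - \<chi> (\<alpha> x) (\<alpha> y) =
          \<psi> (\<alpha> x) (l y) - \<psi> (\<alpha> y) (l x) - l (bracket_g x y)"
        using fibre[rule_format, where x = x and h = 0 and y = y and k = 0]
        by (simp add: \<beta>.zero act.zero algebra_simps)
    qed
    ultimately show "?compatible \<and> ?chi" ..
  next
    assume "?compatible \<and> ?chi"
    then show ?fibre
      by (simp add: algebra_simps)
  qed
  finally show ?thesis .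
qed

text \<open>
  As \<open>\<beta>\<close> commutes with \<open>S\<close>, the fibre coordinate \<open>h\<close> contributes equally to both sides and
  cancels, leaving an equation in \<open>x\<close> alone.
\<close>

lemma block_map_U_iff:
  assumes "Vector_Spaces.linear scale_h scale_h \<beta>"
    and commute_S: "\<And>h. S (\<beta> h) = \<beta> (S h)"
    and commute_T: "\<And>x. T (\<alpha> x) = \<alpha> (T x)"
  shows "U \<circ> block_map \<beta> \<alpha> l = block_map \<beta> \<alpha> l \<circ> U \<longleftrightarrow>
    (\<forall>x. \<beta> (\<Phi> x) - \<Phi> (\<alpha> x) = S (l x) - l (T x))"
proof -
  interpret \<beta>: Vector_Spaces.linear scale_h scale_h \<beta> by fact
  have "U \<circ> block_map \<beta> \<alpha> l = block_map \<beta> \<alpha> l \<circ> U \<longleftrightarrow>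
      (\<forall>x. \<Phi> (\<alpha> x) + S (l x) = l (T x) + \<beta> (\<Phi> x))"
    by (simp add: fun_eq_iff all_coordinates U_coordinates coordinates_eq_iff
        commute_S commute_T S.add \<beta>.add add.assoc[symmetric])
  also have "\<dots> \<longleftrightarrow> (\<forall>x. \<beta> (\<Phi> x) - \<Phi> (\<alpha> x) = S (l x) - l (T x))"
    by (auto simp: algebra_simps)
  finally show ?thesis .
qed

section \<open>Inducible pairs\<close>

text \<open>
  All sections give the same induced map on \<open>\<gg>\<close>: for a block map \<open>\<gamma>\<close>, the value of \<open>p \<circ> \<gamma>\<close>
  depends only on the base coordinate, and that of \<open>s' x\<close> is \<open>x\<close> for every section \<open>s'\<close>.
\<close>

lemma inducible_iff_block_map:
  assumes "Vector_Spaces.linear scale_h scale_h \<beta>"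
    and "Vector_Spaces.linear scale_g scale_g \<alpha>"
    and "bij \<beta>" and "bij \<alpha>"
  shows "inducible scale_g scale_e bracket_e U i p \<beta> \<alpha> \<longleftrightarrow>
    (\<exists>l. Vector_Spaces.linear scale_g scale_h l \<and>
      rb_morphism scale_e bracket_e U scale_e bracket_e U (block_map \<beta> \<alpha> l))"
    (is "_ \<longleftrightarrow> ?blocks")
proof
  assume "inducible scale_g scale_e bracket_e U i p \<beta> \<alpha>"
  then obtain \<gamma> where \<gamma>: "rb_morphism scale_e bracket_e U scale_e bracket_e U \<gamma>"
      "\<And>h. \<gamma> (i h) = i (\<beta> h)" "p \<circ> \<gamma> \<circ> s = \<alpha>"
    using section_s unfolding inducible_def rb_Aut_def by blast
  have "Vector_Spaces.linear scale_e scale_e \<gamma>" and "\<And>x. p (\<gamma> (s x)) = \<alpha> x"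
    using \<gamma> by (auto simp: rb_morphism_def)
  then obtain l where "Vector_Spaces.linear scale_g scale_h l" and "\<gamma> = block_map \<beta> \<alpha> l"
    using \<gamma>(2) block_map_exhaustive by blast
  then show ?blocks
    using \<gamma>(1) by blast
next
  assume ?blocks
  then obtain l where l: "Vector_Spaces.linear scale_g scale_h l"
    and morphism: "rb_morphism scale_e bracket_e U scale_e bracket_e U (block_map \<beta> \<alpha> l)"
    by blast
  interpret \<beta>: Vector_Spaces.linear scale_h scale_h \<beta> by fact
  interpret \<alpha>: Vector_Spaces.linear scale_g scale_g \<alpha> by fact
  interpret l: Vector_Spaces.linear scale_g scale_h l by fact
  let ?\<gamma> = "block_map \<beta> \<alpha> l"
  have "?\<gamma> \<in> rb_Aut scale_e bracket_e U"
    using morphism bij_block_map[OF assms(3,4)] by (simp add: rb_Aut_def)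
  moreover have restrict: "?\<gamma> (i h) = i (\<beta> h)" for h
    using block_map_coordinates[of \<beta> \<alpha> l 0 h] by (simp add: sec.zero \<alpha>.zero l.zero)
  moreover have "?\<gamma> ` range i \<subseteq> range i"
    by (auto simp: restrict)
  moreover have "p \<circ> ?\<gamma> \<circ> s' = \<alpha>" if "is_section scale_g scale_e p s'" for s'
  proof -
    have "p (s' x) = x" for x
      using that unfolding is_section_def by (metis comp_apply id_apply)
    then show ?thesis
      by (simp add: fun_eq_iff block_map_def proj.add)
  qed
  ultimately show "inducible scale_g scale_e bracket_e U i p \<beta> \<alpha>"
    unfolding inducible_def by blast
qed

end

theorem theorem6p2:
  fixes scale_g :: "'k::field_char_0 \<Rightarrow> 'g::ab_group_add \<Rightarrow> 'g"
    and bracket_g :: "'g \<Rightarrow> 'g \<Rightarrow> 'g"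
    and T :: "'g \<Rightarrow> 'g"
    and scale_h :: "'k \<Rightarrow> 'h::ab_group_add \<Rightarrow> 'h"
    and S :: "'h \<Rightarrow> 'h"
    and \<psi> :: "'g \<Rightarrow> 'h \<Rightarrow> 'h"
    and scale_e :: "'k \<Rightarrow> 'e::ab_group_add \<Rightarrow> 'e"
    and bracket_e :: "'e \<Rightarrow> 'e \<Rightarrow> 'e"
    and U :: "'e \<Rightarrow> 'e"
    and i :: "'h \<Rightarrow> 'e"
    and p :: "'e \<Rightarrow> 'g"
    and s :: "'g \<Rightarrow> 'e"
    and \<chi> :: "'g \<Rightarrow> 'g \<Rightarrow> 'h"
    and \<Phi> :: "'g \<Rightarrow> 'h"
    and \<beta> :: "'h \<Rightarrow> 'h"
    and \<alpha> :: "'g \<Rightarrow> 'g"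
  assumes "abelian_extension scale_g bracket_g T scale_h S \<psi> scale_e bracket_e U i p"
    and "is_section scale_g scale_e p s"
    and "\<chi> = cocycle_chi bracket_g bracket_e i s"
    and "\<Phi> = cocycle_Phi T U i s"
    and "\<beta> \<in> rb_Aut scale_h zero_bracket S"
    and "\<alpha> \<in> rb_Aut scale_g bracket_g T"
  shows "inducible scale_g scale_e bracket_e U i p \<beta> \<alpha> \<longleftrightarrow>
    (\<forall>x h. \<beta> (\<psi> x h) - \<psi> (\<alpha> x) (\<beta> h) = 0) \<and>
    (\<exists>l. Vector_Spaces.linear scale_g scale_h l \<and>
      (\<forall>x y. \<beta> (\<chi> x y) - \<chi> (\<alpha> x) (\<alpha> y) =
         \<psi> (\<alpha> x) (l y) - \<psi> (\<alpha> y) (l x) - l (bracket_g x y)) \<and>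
      (\<forall>x. \<beta> (\<Phi> x) - \<Phi> (\<alpha> x) = S (l x) - l (T x)))"
proof -
  interpret sectioned_extension scale_g bracket_g T scale_h S \<psi> scale_e bracket_e U i p s
    using assms(1,2) by (simp add: sectioned_extension_def sectioned_extension_axioms_def)
  have \<beta>: "Vector_Spaces.linear scale_h scale_h \<beta>" "bij \<beta>" "\<And>h. S (\<beta> h) = \<beta> (S h)"
    using assms(5) by (auto simp: rb_Aut_def rb_morphism_def fun_eq_iff)
  have \<alpha>: "Vector_Spaces.linear scale_g scale_g \<alpha>" "bij \<alpha>" "\<And>x. T (\<alpha> x) = \<alpha> (T x)"
      "\<And>x y. \<alpha> (bracket_g x y) = bracket_g (\<alpha> x) (\<alpha> y)"
    using assms(6) by (auto simp: rb_Aut_def rb_morphism_def fun_eq_iff)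
  have "rb_morphism scale_e bracket_e U scale_e bracket_e U (block_map \<beta> \<alpha> l) \<longleftrightarrow>
      (\<forall>x h. \<beta> (\<psi> x h) - \<psi> (\<alpha> x) (\<beta> h) = 0) \<and>
      (\<forall>x y. \<beta> (\<chi> x y) - \<chi> (\<alpha> x) (\<alpha> y) =
         \<psi> (\<alpha> x) (l y) - \<psi> (\<alpha> y) (l x) - l (bracket_g x y)) \<and>
      (\<forall>x. \<beta> (\<Phi> x) - \<Phi> (\<alpha> x) = S (l x) - l (T x))"
    if l: "Vector_Spaces.linear scale_g scale_h l" for l
  proof -
    have U_iff: "U \<circ> block_map \<beta> \<alpha> l = block_map \<beta> \<alpha> l \<circ> U \<longleftrightarrow>
        (\<forall>x. \<beta> (cocycle_Phi T U i s x) - cocycle_Phi T U i s (\<alpha> x) = S (l x) - l (T x))"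
      by (rule block_map_U_iff) (fact \<beta> \<alpha>)+
    show ?thesis
      unfolding rb_morphism_def assms(3,4)
        block_map_bracket_iff[OF \<beta>(1) \<alpha>(1) \<alpha>(4) l] U_iff
      using linear_block_map[OF \<beta>(1) \<alpha>(1) l] by blast
  qed
  then show ?thesis
    unfolding inducible_iff_block_map[OF \<beta>(1) \<alpha>(1) \<beta>(2) \<alpha>(2)] by blast
qed

end
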